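(* (Subject Reduction.) If $\Gamma\vdash P$ and $P\to P'$, then $\Gamma\vdash P'$.
   Context: The calculus AW$\pi$. Besides success names, each name is an I-name (only input subject) or an O-name (only output subject). Values $v::=a\mid\star$. Processes: $P ::= 0 \mid P \mid Q \mid a(x).P \mid \overline{b}\langle v\rangle \mid (\nu\, a \leftrightarrow b : T)P \mid\ !a(x).P$; input and restriction bind; in $(\nu\,a\leftrightarrow b)P$, $a$ is an I-name and $b$ an O-name. Success names are O-names carrying only $\star$, never restricted. Types $T::=o\,T\mid i\,T\mid\mathsf{unit}$, dual of $o\,T$ is $i\,T$ and vice versa. A type environment is a finite set of bindings $a:T$; $I(\Gamma)$ is the set of names with input type in $\Gamma$; $\Gamma_1,\Gamma_2$ is the union, defined only if they agree on shared names. Typing rules: $\Gamma\vdash 0$; if $\Gamma_1\vdash P_1$, $\Gamma_2\vdash P_2$, $I(\Gamma_1)\cap I(\Gamma_2)=\emptyset$ then $\Gamma_1,\Gamma_2\vdash P_1\mid P_2$; if $\Gamma,a:i\,T,b:o\,T\vdash P$ then $\Gamma\vdash(\nu\,a\leftrightarrow b:i\,T)P$; $\Gamma,a:o\,T,b:T\vdash \overline{a}\langle b\rangle$; if $\Gamma,a:i\,T,b:T\vdash P$ then $\Gamma,a:i\,T\vdash a(b).P$; if $\Gamma_o,b:T\vdash P$ where $\Gamma_o$ assigns only output types, then $\Gamma_o,a:i\,T,\Gamma'\vdash\ !a(b).P$. Structural congruence $\equiv$ is the least congruence with: $P\mid0\equiv P$, $P\mid Q\equiv Q\mid P$, $P\mid(Q\mid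 R)\equiv(P\mid Q)\mid R$, $P\mid(\nu\,a\leftrightarrow b)Q\equiv(\nu\,a\leftrightarrow b)(P\mid Q)$ if $a,b\notin\mathrm{fn}(P)$, $(\nu\,a\leftrightarrow b)(\nu\,c\leftrightarrow d)P\equiv(\nu\,c\leftrightarrow d)(\nu\,a\leftrightarrow b)P$, $(\nu\,a\leftrightarrow b)0\equiv0$. Reduction $\to$ is the least relation such that $(\nu\,a\leftrightarrow b)(a(x).P\mid\overline{b}\langle v\rangle\mid Q)\to(\nu\,a\leftrightarrow b)(P\{v/x\}\mid Q)$, $(\nu\,a\leftrightarrow b)(!a(x).P\mid\overline{b}\langle v\rangle\mid Q)\to(\nu\,a\leftrightarrow b)(!a(x).P\mid P\{v/x\}\mid Q)$, if $P\to P'$ then $P\mid Q\to P'\mid Q$ and $(\nu\,a\leftrightarrow b)P\to(\nu\,a\leftrightarrow b)P'$, and if $P\equiv P'\to P''\equiv P'''$ then $P\to P'''$.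
   Formalization: The annotation in (ν a↔b : T)P is taken to be an input type, since otherwise (ν a↔b : unit)0 ≡ 0 refutes the claim; type environments give I-names input types or unit, O-names output types or unit, and success names o unit; the value ⋆ has type unit. *)

theory Defs
  imports Main
begin

section \<open>Names, types and processes\<close>

text \<open>The I-names, the O-names that may be restricted, and the success names form three disjoint
  sorts. Subjects and restricted names have the right sort by typing of the syntax; the object of
  an input may be any name.\<close>

datatype iname = IName nat

datatype oname = OName nat

datatype outname = Plain oname | Success nat

datatype name = I_name iname | O_name outname

abbreviation P_name :: "oname \<Rightarrow> name" where
  "P_name b \<equiv> O_name (Plain b)"

fun same_sort :: "name \<Rightarrow> name \<Rightarrow> bool" where
  "same_sort (I_name _) (I_name _) = True"
| "same_sort (O_name (Plain _)) (O_name (Plain _)) = True"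
| "same_sort (O_name (Success _)) (O_name (Success _)) = True"
| "same_sort _ _ = False"

datatype val = Nm name | Star

datatype ty = OT ty | IT ty | Unit

text \<open>The term \<open>Res a b T P\<close> stands for \<open>(\<nu> a \<leftrightarrow> b : i T) P\<close>: the annotation is the type of the
  I-name \<open>a\<close>, hence an input type, and only the carried type \<open>T\<close> is recorded. (If other annotations
  were syntactically possible, the law \<open>(\<nu> a \<leftrightarrow> b) 0 \<equiv> 0\<close> would relate the typable process \<open>0\<close>
  to untypable ones.)

  These are raw terms; alpha-conversion is part of structural congruence below.\<close>

datatype proc =
    PNil
  | Par proc proc
  | In iname name proc
  | Out outname val
  | Res iname oname ty proc
  | Rep iname name proc

fun val_names :: "val \<Rightarrow> name set" where
  "val_names (Nm n) = {n}"
| "val_names Star = {}"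

fun fn :: "proc \<Rightarrow> name set" where
  "fn PNil = {}"
| "fn (Par P Q) = fn P \<union> fn Q"
| "fn (In a x P) = insert (I_name a) (fn P - {x})"
| "fn (Out b v) = insert (O_name b) (val_names v)"
| "fn (Res a b T P) = fn P - {I_name a, P_name b}"
| "fn (Rep a x P) = insert (I_name a) (fn P - {x})"


section \<open>Substitution\<close>

text \<open>Simultaneous capture-avoiding substitution of values for names. It is partial: the result is
  \<open>None\<close> if a free subject would be replaced by \<open>Star\<close> or by a name of the wrong polarity, since the
  outcome would not be a process. A binder is kept unless it would capture a name, in which case it
  is replaced by a fresh name of the same sort.\<close>

fun subst_val :: "(name \<Rightarrow> val) \<Rightarrow> val \<Rightarrow> val" where
  "subst_val \<sigma> (Nm n) = \<sigma> n"
| "subst_val \<sigma> Star = Star"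

definition subst_isubj :: "(name \<Rightarrow> val) \<Rightarrow> iname \<Rightarrow> iname option" where
  "subst_isubj \<sigma> a = (case \<sigma> (I_name a) of Nm (I_name a') \<Rightarrow> Some a' | _ \<Rightarrow> None)"

definition subst_osubj :: "(name \<Rightarrow> val) \<Rightarrow> outname \<Rightarrow> outname option" where
  "subst_osubj \<sigma> b = (case \<sigma> (O_name b) of Nm (O_name b') \<Rightarrow> Some b' | _ \<Rightarrow> None)"

definition image_names :: "(name \<Rightarrow> val) \<Rightarrow> name set \<Rightarrow> name set" where
  "image_names \<sigma> A = (\<Union>n\<in>A. val_names (\<sigma> n))"

definition fresh_name :: "name \<Rightarrow> name set \<Rightarrow> name" where
  "fresh_name x A = (if x \<notin> A then x else (SOME y. same_sort x y \<and> y \<notin> A))"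

definition fresh_iname :: "iname \<Rightarrow> name set \<Rightarrow> iname" where
  "fresh_iname a A = (if I_name a \<notin> A then a else (SOME a'. I_name a' \<notin> A))"

definition fresh_oname :: "oname \<Rightarrow> name set \<Rightarrow> oname" where
  "fresh_oname b A = (if P_name b \<notin> A then b else (SOME b'. P_name b' \<notin> A))"

fun subst :: "(name \<Rightarrow> val) \<Rightarrow> proc \<Rightarrow> proc option" where
  "subst \<sigma> PNil = Some PNil"
| "subst \<sigma> (Par P Q) =
    Option.bind (subst \<sigma> P) (\<lambda>P'. map_option (\<lambda>Q'. Par P' Q') (subst \<sigma> Q))"
| "subst \<sigma> (In a x P) =
    (let x' = fresh_name x (image_names \<sigma> (fn P - {x}))
     in Option.bind (subst_isubj \<sigma> a)
          (\<lambda>a'. map_option (\<lambda>P'. In a' x' P') (subst (\<sigma>(x := Nm x')) P)))"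
| "subst \<sigma> (Out b v) = map_option (\<lambda>b'. Out b' (subst_val \<sigma> v)) (subst_osubj \<sigma> b)"
| "subst \<sigma> (Res a b T P) =
    (let A = image_names \<sigma> (fn P - {I_name a, P_name b});
         a' = fresh_iname a A;
         b' = fresh_oname b A
     in map_option (\<lambda>P'. Res a' b' T P')
          (subst (\<sigma>(I_name a := Nm (I_name a'), P_name b := Nm (P_name b'))) P))"
| "subst \<sigma> (Rep a x P) =
    (let x' = fresh_name x (image_names \<sigma> (fn P - {x}))
     in Option.bind (subst_isubj \<sigma> a)
          (\<lambda>a'. map_option (\<lambda>P'. Rep a' x' P') (subst (\<sigma>(x := Nm x')) P)))"

definition subst1 :: "proc \<Rightarrow> val \<Rightarrow> name \<Rightarrow> proc option" where
  "subst1 P v x = subst (Nm(x := v)) P"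


section \<open>Structural congruence and reduction\<close>

text \<open>On raw terms, exchanging two restrictions requires their binders to be distinct.\<close>

inductive scong :: "proc \<Rightarrow> proc \<Rightarrow> bool" (infix "\<cong>" 50) where
  refl: "P \<cong> P"
| sym: "P \<cong> Q \<Longrightarrow> Q \<cong> P"
| trans: "P \<cong> Q \<Longrightarrow> Q \<cong> R \<Longrightarrow> P \<cong> R"
| cong_Par: "P \<cong> P' \<Longrightarrow> Q \<cong> Q' \<Longrightarrow> Par P Q \<cong> Par P' Q'"
| cong_In: "P \<cong> P' \<Longrightarrow> In a x P \<cong> In a x P'"
| cong_Res: "P \<cong> P' \<Longrightarrow> Res a b T P \<cong> Res a b T P'"
| cong_Rep: "P \<cong> P' \<Longrightarrow> Rep a x P \<cong> Rep a x P'"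
| alpha_In: "same_sort x y \<Longrightarrow> y \<notin> fn P - {x} \<Longrightarrow> subst1 P (Nm y) x = Some P' \<Longrightarrow>
    In a x P \<cong> In a y P'"
| alpha_Rep: "same_sort x y \<Longrightarrow> y \<notin> fn P - {x} \<Longrightarrow> subst1 P (Nm y) x = Some P' \<Longrightarrow>
    Rep a x P \<cong> Rep a y P'"
| alpha_Res: "{I_name a', P_name b'} \<inter> fn (Res a b T P) = {} \<Longrightarrow>
    subst (Nm(I_name a := Nm (I_name a'), P_name b := Nm (P_name b'))) P = Some P' \<Longrightarrow>
    Res a b T P \<cong> Res a' b' T P'"
| Par_Nil: "Par P PNil \<cong> P"
| Par_comm: "Par P Q \<cong> Par Q P"
| Par_assoc: "Par P (Par Q R) \<cong> Par (Par P Q) R"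
| scope: "{I_name a, P_name b} \<inter> fn P = {} \<Longrightarrow> Par P (Res a b T Q) \<cong> Res a b T (Par P Q)"
| Res_swap: "a \<noteq> c \<Longrightarrow> b \<noteq> d \<Longrightarrow> Res a b T (Res c d U P) \<cong> Res c d U (Res a b T P)"
| Res_Nil: "Res a b T PNil \<cong> PNil"

inductive red :: "proc \<Rightarrow> proc \<Rightarrow> bool" (infix "\<longmapsto>" 50) where
  com: "subst1 P v x = Some P' \<Longrightarrow>
    Res a b T (Par (Par (In a x P) (Out (Plain b) v)) Q) \<longmapsto> Res a b T (Par P' Q)"
| rep: "subst1 P v x = Some P' \<Longrightarrow>
    Res a b T (Par (Par (Rep a x P) (Out (Plain b) v)) Q) \<longmapsto>
    Res a b T (Par (Par (Rep a x P) P') Q)"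
| par: "P \<longmapsto> P' \<Longrightarrow> Par P Q \<longmapsto> Par P' Q"
| res: "P \<longmapsto> P' \<Longrightarrow> Res a b T P \<longmapsto> Res a b T P'"
| struct: "P \<cong> P' \<Longrightarrow> P' \<longmapsto> P'' \<Longrightarrow> P'' \<cong> P''' \<Longrightarrow> P \<longmapsto> P'''"


section \<open>Typing\<close>

type_synonym env = "name \<Rightarrow> ty option"

text \<open>Types respect the sorts of names. Objects of type \<open>Unit\<close> are never subjects, so a name of
  either polarity may have that type; success names carry \<open>Star\<close> only.\<close>

fun sort_ok :: "name \<Rightarrow> ty \<Rightarrow> bool" where
  "sort_ok (I_name _) T \<longleftrightarrow> T = Unit \<or> (\<exists>U. T = IT U)"
| "sort_ok (O_name (Plain _)) T \<longleftrightarrow> T = Unit \<or> (\<exists>U. T = OT U)"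
| "sort_ok (O_name (Success _)) T \<longleftrightarrow> T = OT Unit"

definition tenv :: "env \<Rightarrow> bool" where
  "tenv \<Gamma> \<longleftrightarrow> finite (dom \<Gamma>) \<and> (\<forall>n T. \<Gamma> n = Some T \<longrightarrow> sort_ok n T)"

definition inputs :: "env \<Rightarrow> name set" where
  "inputs \<Gamma> = {n. \<exists>T. \<Gamma> n = Some (IT T)}"

definition agree :: "env \<Rightarrow> env \<Rightarrow> bool" where
  "agree \<Gamma>\<^sub>1 \<Gamma>\<^sub>2 \<longleftrightarrow> (\<forall>n \<in> dom \<Gamma>\<^sub>1 \<inter> dom \<Gamma>\<^sub>2. \<Gamma>\<^sub>1 n = \<Gamma>\<^sub>2 n)"

definition only_outputs :: "env \<Rightarrow> bool" where
  "only_outputs \<Gamma> \<longleftrightarrow> (\<forall>T \<in> ran \<Gamma>. \<exists>U. T = OT U)"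

fun val_typed :: "env \<Rightarrow> val \<Rightarrow> ty \<Rightarrow> bool" where
  "val_typed \<Gamma> (Nm n) T \<longleftrightarrow> \<Gamma> n = Some T"
| "val_typed \<Gamma> Star T \<longleftrightarrow> T = Unit"

text \<open>Binders shadow: on raw terms, extending \<open>\<Gamma>\<close> by a bound name overrides a binding of \<open>\<Gamma>\<close>
  for the same name, which amounts to first renaming the bound name away from \<open>\<Gamma>\<close>. In the rule for
  replication, \<open>\<Gamma>\<^sub>o \<subseteq>\<^sub>m \<Gamma>\<close> and \<open>\<Gamma> a = i T\<close> say that \<open>\<Gamma>\<close> is of the form \<open>\<Gamma>\<^sub>o, a : i T, \<Gamma>'\<close>.\<close>

inductive typed :: "env \<Rightarrow> proc \<Rightarrow> bool" (infix "\<turnstile>" 50) where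
  T_Nil: "tenv \<Gamma> \<Longrightarrow> \<Gamma> \<turnstile> PNil"
| T_Par: "\<Gamma>\<^sub>1 \<turnstile> P\<^sub>1 \<Longrightarrow> \<Gamma>\<^sub>2 \<turnstile> P\<^sub>2 \<Longrightarrow> agree \<Gamma>\<^sub>1 \<Gamma>\<^sub>2 \<Longrightarrow> inputs \<Gamma>\<^sub>1 \<inter> inputs \<Gamma>\<^sub>2 = {} \<Longrightarrow>
    \<Gamma>\<^sub>1 ++ \<Gamma>\<^sub>2 \<turnstile> Par P\<^sub>1 P\<^sub>2"
| T_Res: "tenv \<Gamma> \<Longrightarrow> \<Gamma>(I_name a \<mapsto> IT T, P_name b \<mapsto> OT T) \<turnstile> P \<Longrightarrow> \<Gamma> \<turnstile> Res a b T P"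
| T_Out: "tenv \<Gamma> \<Longrightarrow> \<Gamma> (O_name b) = Some (OT T) \<Longrightarrow> val_typed \<Gamma> v T \<Longrightarrow> \<Gamma> \<turnstile> Out b v"
| T_In: "tenv \<Gamma> \<Longrightarrow> \<Gamma> (I_name a) = Some (IT T) \<Longrightarrow> \<Gamma>(x \<mapsto> T) \<turnstile> P \<Longrightarrow> \<Gamma> \<turnstile> In a x P"
| T_Rep: "tenv \<Gamma> \<Longrightarrow> \<Gamma> (I_name a) = Some (IT T) \<Longrightarrow> \<Gamma>\<^sub>o \<subseteq>\<^sub>m \<Gamma> \<Longrightarrow> only_outputs \<Gamma>\<^sub>o \<Longrightarrow>
    \<Gamma>\<^sub>o(x \<mapsto> T) \<turnstile> P \<Longrightarrow> \<Gamma> \<turnstile> Rep a x P"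

end

(* Weakening, strengthening and the typing of communication all follow from one substitution lemma:
   a substitution that sends free names to values of the same type preserves typing provided that it
   does not identify two input names, so that the splitting of inputs at a parallel composition can
   be transported along it. Since alpha-conversion is symmetric, the converse is also needed, that
   typing is reflected by renamings. *)
theory Submission
  imports Defs
begin

section \<open>Environments and fresh names\<close>

text \<open>The obstacle is that inputs are split, not shared, at a parallel composition:
  \<open>T_Par\<close> asks for disjoint \<open>inputs\<close>, so two inputs living in different
  components must not receive the same image. In a communication the split itself guarantees this: a
  transmitted input name belongs to the environment of the sender, whose inputs are disjoint from
  those of the receiver, so it differs from every input that the receiver's body already owns. For a
  replicated input, the body is typed with output types only, apart from its parameter, so a new
  copy claims no inputs besides those of the output that it consumes. A second obstacle is the raw
  syntax: binders shadow entries of the environment, and substitution may rename them. Conditions on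
  substitutions therefore concern free names only and leave source and target environments otherwise
  unrelated; the identity substitution then changes the environment of a fixed process. Invariance
  under structural congruence is proved as an equivalence, for all environments at once, which
  absorbs both the symmetry rule and the congruence rules for binders.\<close>

lemma finite_val_names: "finite (val_names v)"
  by (cases v) auto

lemma finite_fn: "finite (fn P)"
  by (induction P) (auto simp: finite_val_names)

lemma finite_image_names: "finite A \<Longrightarrow> finite (image_names \<sigma> A)"
  by (auto simp: image_names_def finite_val_names)

lemma image_namesI: "n \<in> A \<Longrightarrow> \<sigma> n = Nm m \<Longrightarrow> m \<in> image_names \<sigma> A"
  by (force simp: image_names_def)

lemma same_sort_refl: "same_sort x x"
  by (cases x) (simp_all, metis name.exhaust outname.exhaust same_sort.simps(2,3))

lemma infinite_same_sort: "infinite {y. same_sort x y}"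
proof -
  have "\<exists>f :: nat \<Rightarrow> name. inj f \<and> range f \<subseteq> {y. same_sort x y}"
  \<comment> \<open>Case analysis on the diagonal leaves one case per sort, witnessed by the
    numbered names of that sort; the mixed cases are contradictory.\<close>
  proof (cases "(x, x)" rule: same_sort.cases)
    case 1
    then show ?thesis by (intro exI[of _ "\<lambda>k. I_name (IName k)"]) (auto simp: inj_def)
  next
    case 2
    then show ?thesis by (intro exI[of _ "\<lambda>k. P_name (OName k)"]) (auto simp: inj_def)
  next
    case 3
    then show ?thesis by (intro exI[of _ "\<lambda>k. O_name (Success k)"]) (auto simp: inj_def)
  qed auto
  then show ?thesis
    by (metis finite_imageD finite_subset infinite_UNIV_nat)
qed

lemma fresh_name:
  assumes "finite A"
  shows "same_sort x (fresh_name x A)" "fresh_name x A \<notin> A"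
proof -
  have "\<exists>y. same_sort x y \<and> y \<notin> A"
    using infinite_same_sort[of x] assms by (metis finite_subset mem_Collect_eq subsetI)
  from someI_ex[OF this] show "same_sort x (fresh_name x A)" "fresh_name x A \<notin> A"
    by (auto simp: fresh_name_def same_sort_refl)
qed

lemma fresh_iname:
  assumes "finite A"
  shows "I_name (fresh_iname a A) \<notin> A"
proof -
  have "infinite (range (\<lambda>k. I_name (IName k)))"
    by (auto dest!: finite_imageD simp: inj_def)
  then have "\<exists>a'. I_name a' \<notin> A"
    using assms by (metis finite_subset image_subsetI)
  from someI_ex[OF this] show ?thesis
    by (auto simp: fresh_iname_def)
qed

lemma fresh_oname:
  assumes "finite A"
  shows "P_name (fresh_oname b A) \<notin> A"
proof -
  have "infinite (range (\<lambda>k. P_name (OName k)))"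
    by (auto dest!: finite_imageD simp: inj_def)
  then have "\<exists>b'. P_name b' \<notin> A"
    using assms by (metis finite_subset image_subsetI)
  from someI_ex[OF this] show ?thesis
    by (auto simp: fresh_oname_def)
qed

section \<open>Well-sorted type environments\<close>

lemma sort_ok_cong: "same_sort x y \<Longrightarrow> sort_ok x T \<longleftrightarrow> sort_ok y T"
  by (cases "(x, y)" rule: same_sort.cases) auto

lemma tenv_empty: "tenv Map.empty"
  by (simp add: tenv_def)

lemma tenv_upd: "tenv \<Gamma> \<Longrightarrow> sort_ok x T \<Longrightarrow> tenv (\<Gamma>(x \<mapsto> T))"
  by (auto simp: tenv_def)

lemma tenv_upd_sort: "tenv (\<Gamma>(x \<mapsto> T)) \<Longrightarrow> sort_ok x T"
  by (auto simp: tenv_def)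

text \<open>For renamed binders: whether a type suits a name depends only on the sort of the name.
  The disjunction serves both directions, since a binder is renamed along a substitution and back
  again when typing is reflected.\<close>

lemma tenv_upd_same_sort:
  "tenv (\<Gamma>(x \<mapsto> T)) \<Longrightarrow> same_sort x y \<or> same_sort y x \<Longrightarrow> tenv \<Delta> \<Longrightarrow> tenv (\<Delta>(y \<mapsto> T))"
  using sort_ok_cong tenv_upd tenv_upd_sort by blast

lemma tenv_upd_Res: "tenv \<Gamma> \<Longrightarrow> tenv (\<Gamma>(I_name a \<mapsto> IT T, P_name b \<mapsto> OT T))"
  by (intro tenv_upd) auto

lemma map_leD: "\<Delta> \<subseteq>\<^sub>m \<Gamma> \<Longrightarrow> \<Delta> n = Some T \<Longrightarrow> \<Gamma> n = Some T"
  unfolding map_le_def by (metis domI)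

lemma tenv_mono: "tenv \<Gamma> \<Longrightarrow> \<Delta> \<subseteq>\<^sub>m \<Gamma> \<Longrightarrow> tenv \<Delta>"
  unfolding tenv_def by (meson finite_subset map_le_implies_dom_le map_leD)

lemma map_le_restrict: "\<Gamma> |` A \<subseteq>\<^sub>m \<Gamma>"
  by (auto simp: map_le_def)

lemma tenv_restrict: "tenv \<Gamma> \<Longrightarrow> tenv (\<Gamma> |` A)"
  using tenv_mono map_le_restrict by blast

lemma tenv_add: "tenv \<Gamma> \<Longrightarrow> tenv \<Delta> \<Longrightarrow> tenv (\<Gamma> ++ \<Delta>)"
  by (auto simp: tenv_def)

lemma typed_tenv: "\<Gamma> \<turnstile> P \<Longrightarrow> tenv \<Gamma>"
  by (induction rule: typed.induct) (auto intro: tenv_add)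

section \<open>Agreement and union of environments\<close>

lemma agreeI: "(\<And>n T U. \<Gamma> n = Some T \<Longrightarrow> \<Delta> n = Some U \<Longrightarrow> T = U) \<Longrightarrow> agree \<Gamma> \<Delta>"
  unfolding agree_def by (metis IntD1 IntD2 domD)

lemma agreeD: "agree \<Gamma> \<Delta> \<Longrightarrow> \<Gamma> n = Some T \<Longrightarrow> \<Delta> n = Some U \<Longrightarrow> T = U"
  unfolding agree_def by (metis IntI domI option.inject)

text \<open>The operator \<open>++\<close> favours its right argument; agreement is what turns it
  into the symmetric union of the calculus.\<close>

lemma agree_add_left: "agree \<Gamma> \<Delta> \<Longrightarrow> \<Gamma> n = Some T \<Longrightarrow> (\<Gamma> ++ \<Delta>) n = Some T"
  by (auto simp: map_add_def split: option.splits dest: agreeD)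

lemma agree_sym: "agree \<Gamma> \<Delta> \<Longrightarrow> agree \<Delta> \<Gamma>"
  by (rule agreeI) (blast dest: agreeD)

lemma agree_add_comm: "agree \<Gamma> \<Delta> \<Longrightarrow> \<Gamma> ++ \<Delta> = \<Delta> ++ \<Gamma>"
  by (rule ext) (auto simp: map_add_def split: option.splits dest: agreeD)

lemma inputs_add: "agree \<Gamma> \<Delta> \<Longrightarrow> inputs (\<Gamma> ++ \<Delta>) = inputs \<Gamma> \<union> inputs \<Delta>"
  by (auto simp: inputs_def dest: agree_add_left)

lemma agree_mono: "agree \<Gamma> \<Theta> \<Longrightarrow> \<Delta> \<subseteq>\<^sub>m \<Gamma> \<Longrightarrow> agree \<Delta> \<Theta>"
  by (rule agreeI) (blast dest: agreeD map_leD)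

lemma agree_add_iff:
  assumes "agree \<Gamma> \<Delta>"
  shows "agree (\<Gamma> ++ \<Delta>) \<Theta> \<longleftrightarrow> agree \<Gamma> \<Theta> \<and> agree \<Delta> \<Theta>"
proof
  assume "agree (\<Gamma> ++ \<Delta>) \<Theta>"
  then show "agree \<Gamma> \<Theta> \<and> agree \<Delta> \<Theta>"
    using agree_mono map_le_map_add agree_add_comm[OF assms] by metis
next
  assume "agree \<Gamma> \<Theta> \<and> agree \<Delta> \<Theta>"
  then show "agree (\<Gamma> ++ \<Delta>) \<Theta>"
    by (intro agreeI) (blast dest: agreeD)
qed

lemma val_typed_mono: "val_typed \<Delta> v T \<Longrightarrow> \<Delta> \<subseteq>\<^sub>m \<Gamma> \<Longrightarrow> val_typed \<Gamma> v T"
  by (cases v) (auto dest: map_leD)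

text \<open>The largest sub-environment with output types only, hence a canonical choice of
  \<open>\<Gamma>\<^sub>o\<close> in \<open>T_Rep\<close>.\<close>

abbreviation outputs_part :: "env \<Rightarrow> env" where
  "outputs_part \<Gamma> \<equiv> \<Gamma> |` {n. \<exists>U. \<Gamma> n = Some (OT U)}"

lemma only_outputs_outputs_part: "only_outputs (outputs_part \<Gamma>)"
  by (auto simp: only_outputs_def ran_def restrict_map_def split: if_splits)

lemma only_outputsD: "only_outputs \<Gamma> \<Longrightarrow> \<Gamma> n = Some T \<Longrightarrow> \<exists>U. T = OT U"
  by (auto simp: only_outputs_def ran_def)

text \<open>Reduces finding a split to choosing a set \<open>S\<close>: the inputs in
  \<open>S\<close> go to the left component, the other inputs to the right one, and everything that
  is not an input is shared by both.\<close>

lemma typed_Par_split: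
  assumes "\<Gamma> |` (- (inputs \<Gamma> - S)) \<turnstile> P" "\<Gamma> |` (- (inputs \<Gamma> \<inter> S)) \<turnstile> Q"
  shows "\<Gamma> \<turnstile> Par P Q"
proof -
  let ?\<Gamma>\<^sub>1 = "\<Gamma> |` (- (inputs \<Gamma> - S))" and ?\<Gamma>\<^sub>2 = "\<Gamma> |` (- (inputs \<Gamma> \<inter> S))"
  have "?\<Gamma>\<^sub>1 ++ ?\<Gamma>\<^sub>2 = \<Gamma>"
    by (rule ext) (auto simp: map_add_def restrict_map_def split: option.splits)
  moreover have "agree ?\<Gamma>\<^sub>1 ?\<Gamma>\<^sub>2"
    by (rule agreeI) (auto simp: restrict_map_def split: if_splits)
  moreover have "inputs ?\<Gamma>\<^sub>1 \<inter> inputs ?\<Gamma>\<^sub>2 = {}"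
    by (auto simp: inputs_def restrict_map_def split: if_splits)
  ultimately show ?thesis
    using T_Par[OF assms] by simp
qed

section \<open>Inversion of typing and of substitution on subjects\<close>

inductive_cases typed_NilE: "\<Gamma> \<turnstile> PNil"
inductive_cases typed_ParE: "\<Gamma> \<turnstile> Par P Q"
inductive_cases typed_ResE: "\<Gamma> \<turnstile> Res a b T P"
inductive_cases typed_OutE: "\<Gamma> \<turnstile> Out b v"
inductive_cases typed_InE: "\<Gamma> \<turnstile> In a x P"
inductive_cases typed_RepE: "\<Gamma> \<turnstile> Rep a x P"

lemma subst_isubj_SomeD: "subst_isubj \<sigma> a = Some a' \<Longrightarrow> \<sigma> (I_name a) = Nm (I_name a')"
  by (auto simp: subst_isubj_def split: val.splits name.splits)

lemma subst_osubj_SomeD: "subst_osubj \<sigma> b = Some b' \<Longrightarrow> \<sigma> (O_name b) = Nm (O_name b')"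
  by (auto simp: subst_osubj_def split: val.splits name.splits)


section \<open>Substitution and typing\<close>

text \<open>Here \<open>A\<close> stands for the free names of the process. Injectivity is asked on
  inputs only, because output and unit names may be shared by parallel components and so may be
  identified freely.\<close>

definition subst_typed :: "env \<Rightarrow> name set \<Rightarrow> (name \<Rightarrow> val) \<Rightarrow> env \<Rightarrow> bool" where
  "subst_typed \<Gamma> A \<sigma> \<Delta> \<longleftrightarrow>
    (\<forall>n\<in>A. \<forall>T. \<Gamma> n = Some T \<longrightarrow> val_typed \<Delta> (\<sigma> n) T) \<and> inj_on \<sigma> (A \<inter> inputs \<Gamma>)"

text \<open>For going under a binder \<open>x\<close> renamed to \<open>y\<close>: as
  \<open>y\<close> is not the image of another name in \<open>A\<close>, overriding \<open>y\<close>
  in \<open>\<Delta>\<close> disturbs no other image, and \<open>x\<close> cannot collide with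
  another input.\<close>

lemma subst_typed_upd:
  assumes "subst_typed \<Gamma> (A - {x}) \<sigma> \<Delta>" "y \<notin> image_names \<sigma> (A - {x})"
  shows "subst_typed (\<Gamma>(x \<mapsto> T)) A (\<sigma>(x := Nm y)) (\<Delta>(y \<mapsto> T))"
proof -
  have fresh: "\<sigma> n \<noteq> Nm y" if "n \<in> A" "n \<noteq> x" for n
    using assms(2) image_namesI[of n "A - {x}" \<sigma> y] that by auto
  have vt: "val_typed (\<Delta>(y \<mapsto> T)) ((\<sigma>(x := Nm y)) n) U"
    if "n \<in> A" "(\<Gamma>(x \<mapsto> T)) n = Some U" for n U
  proof (cases "n = x")
    case False
    then have "val_typed \<Delta> (\<sigma> n) U"
      using that assms(1) by (auto simp: subst_typed_def)
    then show ?thesis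
      using False fresh[OF that(1)] by (cases "\<sigma> n") auto
  qed (use that in simp)
  have inj: "inj_on \<sigma> ((A - {x}) \<inter> inputs \<Gamma>)"
    using assms(1) by (simp add: subst_typed_def)
  have "inj_on (\<sigma>(x := Nm y)) (A \<inter> inputs (\<Gamma>(x \<mapsto> T)))"
  proof (rule inj_onI)
    fix n m
    assume *: "n \<in> A \<inter> inputs (\<Gamma>(x \<mapsto> T))" "m \<in> A \<inter> inputs (\<Gamma>(x \<mapsto> T))"
      "(\<sigma>(x := Nm y)) n = (\<sigma>(x := Nm y)) m"
    have inp: "k \<in> inputs \<Gamma>" if "k \<in> inputs (\<Gamma>(x \<mapsto> T))" "k \<noteq> x" for k
      using that by (auto simp: inputs_def)
    show "n = m"
    proof (cases "n = x \<or> m = x")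
      case True
      then show ?thesis using * fresh by (metis IntD1 fun_upd_apply)
    next
      case False
      then show ?thesis using * inp inj_onD[OF inj, of n m] by auto
    qed
  qed
  then show ?thesis
    using vt by (auto simp: subst_typed_def)
qed

text \<open>\<open>Star\<close> has type \<open>Unit\<close> only, so a value of output type is a
  name and survives the restriction of \<open>\<Delta>\<close> to outputs. Injectivity becomes
  vacuous, as \<open>\<Gamma>\<^sub>o\<close> has no inputs.\<close>

lemma subst_typed_outputs:
  assumes "subst_typed \<Gamma> A \<sigma> \<Delta>" "\<Gamma>\<^sub>o \<subseteq>\<^sub>m \<Gamma>" "only_outputs \<Gamma>\<^sub>o"
  shows "subst_typed \<Gamma>\<^sub>o A \<sigma> (outputs_part \<Delta>)"
proof -
  have "val_typed (outputs_part \<Delta>) (\<sigma> n) T" if n: "n \<in> A" "\<Gamma>\<^sub>o n = Some T" for n T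
  proof -
    obtain U where "T = OT U" using only_outputsD[OF assms(3) n(2)] by auto
    moreover have "val_typed \<Delta> (\<sigma> n) T"
      using assms(1,2) n by (auto simp: subst_typed_def dest: map_leD)
    ultimately show ?thesis by (cases "\<sigma> n") auto
  qed
  moreover have "inputs \<Gamma>\<^sub>o = {}"
    using assms(3) by (auto simp: inputs_def dest: only_outputsD)
  ultimately show ?thesis by (auto simp: subst_typed_def)
qed

text \<open>Each process constructor has exactly one typing rule, so structural induction with
  inversion suffices. The delicate case is parallel composition, where the split of
  \<open>\<Gamma>\<close> has to be turned into a split of \<open>\<Delta>\<close>.\<close>

lemma typed_subst:
  assumes "\<Gamma> \<turnstile> P" "subst \<sigma> P = Some P'" "tenv \<Delta>" "subst_typed \<Gamma> (fn P) \<sigma> \<Delta>"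
  shows "\<Delta> \<turnstile> P'"
  using assms
proof (induction P arbitrary: \<Gamma> \<sigma> \<Delta> P' rule: proc.induct)
  case PNil
  then show ?case by (auto intro: T_Nil)
next
  case (Par P Q)
  from Par.prems(1) obtain \<Gamma>\<^sub>1 \<Gamma>\<^sub>2 where \<Gamma>: "\<Gamma> = \<Gamma>\<^sub>1 ++ \<Gamma>\<^sub>2" "\<Gamma>\<^sub>1 \<turnstile> P" "\<Gamma>\<^sub>2 \<turnstile> Q"
    "agree \<Gamma>\<^sub>1 \<Gamma>\<^sub>2" "inputs \<Gamma>\<^sub>1 \<inter> inputs \<Gamma>\<^sub>2 = {}"
    by (auto elim: typed_ParE)
  from Par.prems(2) obtain P\<^sub>1 Q\<^sub>1 where P': "subst \<sigma> P = Some P\<^sub>1" "subst \<sigma> Q = Some Q\<^sub>1"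
    "P' = Par P\<^sub>1 Q\<^sub>1"
    by (auto simp: bind_eq_Some_conv)
  have vt: "val_typed \<Delta> (\<sigma> n) T" if "n \<in> fn P \<union> fn Q" "\<Gamma> n = Some T" for n T
    using Par.prems(4) that by (auto simp: subst_typed_def)
  have inj: "inj_on \<sigma> ((fn P \<union> fn Q) \<inter> (inputs \<Gamma>\<^sub>1 \<union> inputs \<Gamma>\<^sub>2))"
    using Par.prems(4) \<Gamma> by (simp add: subst_typed_def inputs_add)
  \<comment> \<open>The images of the inputs that the left component really uses; all remaining
    inputs of \<open>\<Delta>\<close> are handed to the right one.\<close>
  define S where "S = {m. \<exists>n \<in> fn P \<inter> inputs \<Gamma>\<^sub>1. \<sigma> n = Nm m}"
  have "subst_typed \<Gamma>\<^sub>1 (fn P) \<sigma> (\<Delta> |` (- (inputs \<Delta> - S)))"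
    unfolding subst_typed_def
  proof (intro conjI ballI allI impI)
    fix n T assume n: "n \<in> fn P" "\<Gamma>\<^sub>1 n = Some T"
    then have "val_typed \<Delta> (\<sigma> n) T"
      using vt \<Gamma>(1,4) agree_add_left by blast
    then show "val_typed (\<Delta> |` (- (inputs \<Delta> - S))) (\<sigma> n) T"
      using n by (cases "\<sigma> n") (auto simp: restrict_map_def inputs_def S_def)
  qed (rule inj_on_subset[OF inj], auto)
  moreover have "subst_typed \<Gamma>\<^sub>2 (fn Q) \<sigma> (\<Delta> |` (- (inputs \<Delta> \<inter> S)))"
    unfolding subst_typed_def
  proof (intro conjI ballI allI impI)
    fix n T assume n: "n \<in> fn Q" "\<Gamma>\<^sub>2 n = Some T"
    then have *: "val_typed \<Delta> (\<sigma> n) T"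
      using vt \<Gamma>(1) by simp
    \<comment> \<open>An input of the right component with image in \<open>S\<close> would share
      that image with an input of the left one; injectivity would make the two names equal, against
      disjointness of the split of \<open>\<Gamma>\<close>.\<close>
    have "m \<notin> S" if m: "\<sigma> n = Nm m" "m \<in> inputs \<Delta>" for m
    proof
      assume "m \<in> S"
      then obtain k where k: "k \<in> fn P" "k \<in> inputs \<Gamma>\<^sub>1" "\<sigma> k = \<sigma> n"
        using m by (auto simp: S_def)
      have "n \<in> inputs \<Gamma>\<^sub>2" using * m n by (auto simp: inputs_def)
      then show False
        using k n \<Gamma>(5) inj_onD[OF inj k(3)] by auto
    qed
    then show "val_typed (\<Delta> |` (- (inputs \<Delta> \<inter> S))) (\<sigma> n) T"
      using * by (cases "\<sigma> n") (auto simp: restrict_map_def)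
  qed (rule inj_on_subset[OF inj], auto)
  ultimately show ?case
    unfolding P'(3) using Par.IH \<Gamma> P' tenv_restrict[OF Par.prems(3)]
    by (intro typed_Par_split) blast+
next
  case (In a x P)
  let ?x = "fresh_name x (image_names \<sigma> (fn P - {x}))"
  from In.prems(1) obtain T where T: "\<Gamma> (I_name a) = Some (IT T)" "\<Gamma>(x \<mapsto> T) \<turnstile> P"
    by (auto elim: typed_InE)
  from In.prems(2) obtain a' Q where Q: "subst_isubj \<sigma> a = Some a'"
    "subst (\<sigma>(x := Nm ?x)) P = Some Q" "P' = In a' ?x Q"
    by (auto simp: bind_eq_Some_conv Let_def)
  have "\<Delta> (I_name a') = Some (IT T)"
    using In.prems(4) T(1) subst_isubj_SomeD[OF Q(1)] by (force simp: subst_typed_def)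
  moreover have "\<Delta>(?x \<mapsto> T) \<turnstile> Q"
  proof (rule In.IH[OF T(2) Q(2)])
    show "tenv (\<Delta>(?x \<mapsto> T))"
      using tenv_upd_same_sort typed_tenv[OF T(2)] In.prems(3) fresh_name(1) finite_fn
        finite_image_names by (meson finite_Diff)
    have "subst_typed \<Gamma> (fn P - {x}) \<sigma> \<Delta>"
      using In.prems(4) by (auto simp: subst_typed_def intro: inj_on_subset)
    then show "subst_typed (\<Gamma>(x \<mapsto> T)) (fn P) (\<sigma>(x := Nm ?x)) (\<Delta>(?x \<mapsto> T))"
      by (rule subst_typed_upd) (simp add: fresh_name finite_fn finite_image_names)
  qed
  ultimately show ?case
    unfolding Q(3) using In.prems(3) by (rule T_In[rotated])
next
  case (Out b v)
  from Out.prems(1) obtain T where T: "\<Gamma> (O_name b) = Some (OT T)" "val_typed \<Gamma> v T"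
    by (auto elim: typed_OutE)
  from Out.prems(2) obtain b' where b': "subst_osubj \<sigma> b = Some b'" "P' = Out b' (subst_val \<sigma> v)"
    by auto
  have "\<Delta> (O_name b') = Some (OT T)"
    using Out.prems(4) T(1) subst_osubj_SomeD[OF b'(1)] by (force simp: subst_typed_def)
  moreover have "val_typed \<Delta> (subst_val \<sigma> v) T"
    using Out.prems(4) T(2) by (cases v) (auto simp: subst_typed_def)
  ultimately show ?case
    unfolding b'(2) using Out.prems(3) by (rule T_Out[rotated])
next
  case (Res a b T P)
  define A where "A = image_names \<sigma> (fn P - {I_name a, P_name b})"
  define a' where "a' = fresh_iname a A"
  define b' where "b' = fresh_oname b A"
  have fin: "finite A" by (simp add: A_def finite_fn finite_image_names)
  from Res.prems(1) have vt: "\<Gamma>(I_name a \<mapsto> IT T, P_name b \<mapsto> OT T) \<turnstile> P"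
    by (auto elim: typed_ResE)
  from Res.prems(2) obtain Q where Q:
    "subst (\<sigma>(I_name a := Nm (I_name a'), P_name b := Nm (P_name b'))) P = Some Q"
    "P' = Res a' b' T Q"
    by (auto simp: Let_def A_def a'_def b'_def)
  \<comment> \<open>The two binders are added one at a time. In the second addition, the image of
    \<open>I_name a\<close> is an I-name and thus cannot clash with
    \<open>P_name b'\<close>.\<close>
  have "subst_typed \<Gamma> (fn P - {P_name b} - {I_name a}) \<sigma> \<Delta>"
    using Res.prems(4) by (auto simp: subst_typed_def intro: inj_on_subset)
  then have "subst_typed (\<Gamma>(I_name a \<mapsto> IT T)) (fn P - {P_name b})
      (\<sigma>(I_name a := Nm (I_name a'))) (\<Delta>(I_name a' \<mapsto> IT T))"
    by (rule subst_typed_upd)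
      (use fresh_iname[OF fin, of a] in \<open>auto simp: A_def a'_def image_names_def\<close>)
  then have "subst_typed (\<Gamma>(I_name a \<mapsto> IT T, P_name b \<mapsto> OT T)) (fn P)
      (\<sigma>(I_name a := Nm (I_name a'), P_name b := Nm (P_name b')))
      (\<Delta>(I_name a' \<mapsto> IT T, P_name b' \<mapsto> OT T))"
    by (rule subst_typed_upd)
      (use fresh_oname[OF fin, of b] in \<open>auto simp: A_def b'_def image_names_def split: if_splits\<close>)
  then have "\<Delta>(I_name a' \<mapsto> IT T, P_name b' \<mapsto> OT T) \<turnstile> Q"
    using Res.IH[OF vt Q(1)] tenv_upd_Res Res.prems(3) by blast
  then show ?case
    unfolding Q(2) using Res.prems(3) by (rule T_Res[rotated])
next
  case (Rep a x P)
  let ?x = "fresh_name x (image_names \<sigma> (fn P - {x}))"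
  from Rep.prems(1) obtain T \<Gamma>\<^sub>o where T: "\<Gamma> (I_name a) = Some (IT T)" "\<Gamma>\<^sub>o(x \<mapsto> T) \<turnstile> P"
    "\<Gamma>\<^sub>o \<subseteq>\<^sub>m \<Gamma>" "only_outputs \<Gamma>\<^sub>o"
    by (auto elim: typed_RepE)
  from Rep.prems(2) obtain a' Q where Q: "subst_isubj \<sigma> a = Some a'"
    "subst (\<sigma>(x := Nm ?x)) P = Some Q" "P' = Rep a' ?x Q"
    by (auto simp: bind_eq_Some_conv Let_def)
  have "\<Delta> (I_name a') = Some (IT T)"
    using Rep.prems(4) T(1) subst_isubj_SomeD[OF Q(1)] by (force simp: subst_typed_def)
  \<comment> \<open>The images of names of output type have output type again, so the outputs of
    \<open>\<Delta>\<close> are enough for the replicated body.\<close>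
  moreover have "(outputs_part \<Delta>)(?x \<mapsto> T) \<turnstile> Q"
  proof (rule Rep.IH[OF T(2) Q(2)])
    show "tenv ((outputs_part \<Delta>)(?x \<mapsto> T))"
      using tenv_upd_same_sort typed_tenv[OF T(2)] tenv_restrict[OF Rep.prems(3)] fresh_name(1)
        finite_fn finite_image_names by (meson finite_Diff)
    have "subst_typed \<Gamma> (fn P - {x}) \<sigma> \<Delta>"
      using Rep.prems(4) by (auto simp: subst_typed_def intro: inj_on_subset)
    then have "subst_typed \<Gamma>\<^sub>o (fn P - {x}) \<sigma> (outputs_part \<Delta>)"
      using T(3,4) by (rule subst_typed_outputs)
    then show "subst_typed (\<Gamma>\<^sub>o(x \<mapsto> T)) (fn P) (\<sigma>(x := Nm ?x)) ((outputs_part \<Delta>)(?x \<mapsto> T))"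
      by (rule subst_typed_upd) (simp add: fresh_name finite_fn finite_image_names)
  qed
  ultimately show ?case
    unfolding Q(3)
    using T_Rep[OF Rep.prems(3)] map_le_restrict only_outputs_outputs_part by blast
qed

text \<open>Under the identity a binder \<open>x\<close> is never among the images of
  \<open>fn P - {x}\<close>, so the fresh-name functions keep every binder.\<close>

lemma subst_Nm: "subst Nm P = Some P"
proof (induction P)
  case (Out b v)
  then show ?case by (cases v) (auto simp: subst_osubj_def)
qed (auto simp: fresh_name_def fresh_iname_def fresh_oname_def image_names_def subst_isubj_def
    Let_def)

text \<open>The identity instance of \<open>typed_subst\<close>, with trivial injectivity: it gives
  weakening and, for names that are not free, strengthening.\<close>

lemma typed_cong:
  assumes "\<Gamma> \<turnstile> P" "tenv \<Delta>" "\<And>n T. n \<in> fn P \<Longrightarrow> \<Gamma> n = Some T \<Longrightarrow> \<Delta> n = Some T"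
  shows "\<Delta> \<turnstile> P"
  using typed_subst[OF assms(1) subst_Nm assms(2)] assms(3)
  by (auto simp: subst_typed_def inj_on_def)

lemma typed_weaken: "\<Gamma> \<turnstile> P \<Longrightarrow> \<Gamma> \<subseteq>\<^sub>m \<Delta> \<Longrightarrow> tenv \<Delta> \<Longrightarrow> \<Delta> \<turnstile> P"
  by (erule typed_cong) (auto dest: map_leD)

text \<open>No injectivity is needed here: undoing an identification of names only makes the inputs
  of parallel components easier to separate.\<close>

lemma typed_subst_reflect:
  assumes "\<Delta> \<turnstile> P'" "subst \<sigma> P = Some P'" "tenv \<Gamma>" "\<And>n. \<sigma> n \<noteq> Star"
    "\<And>n T. n \<in> fn P \<Longrightarrow> val_typed \<Delta> (\<sigma> n) T \<Longrightarrow> \<Gamma> n = Some T"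
  shows "\<Gamma> \<turnstile> P"
  using assms
proof (induction P arbitrary: \<Gamma> \<sigma> \<Delta> P' rule: proc.induct)
  case PNil
  then show ?case by (auto intro: T_Nil)
next
  case (Par P Q)
  from Par.prems(2) obtain P\<^sub>1 Q\<^sub>1 where P': "subst \<sigma> P = Some P\<^sub>1" "subst \<sigma> Q = Some Q\<^sub>1"
    "P' = Par P\<^sub>1 Q\<^sub>1"
    by (auto simp: bind_eq_Some_conv)
  from Par.prems(1) obtain \<Delta>\<^sub>1 \<Delta>\<^sub>2 where \<Delta>: "\<Delta> = \<Delta>\<^sub>1 ++ \<Delta>\<^sub>2" "\<Delta>\<^sub>1 \<turnstile> P\<^sub>1" "\<Delta>\<^sub>2 \<turnstile> Q\<^sub>1"
    "agree \<Delta>\<^sub>1 \<Delta>\<^sub>2" "inputs \<Delta>\<^sub>1 \<inter> inputs \<Delta>\<^sub>2 = {}"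
    by (auto simp: P' elim: typed_ParE)
  \<comment> \<open>Dual to the choice made for \<open>typed_subst\<close>: a preimage instead of an
    image, consisting of the names sent to inputs of the left environment.\<close>
  define S where "S = {n. \<exists>m \<in> inputs \<Delta>\<^sub>1. \<sigma> n = Nm m}"
  show ?case
  proof (rule typed_Par_split)
    show "\<Gamma> |` (- (inputs \<Gamma> - S)) \<turnstile> P"
    proof (rule Par.IH(1)[OF \<Delta>(2) P'(1) tenv_restrict[OF Par.prems(3)] Par.prems(4)])
      fix n T assume n: "n \<in> fn P" "val_typed \<Delta>\<^sub>1 (\<sigma> n) T"
      obtain m where m: "\<sigma> n = Nm m" using Par.prems(4)[of n] by (cases "\<sigma> n") auto
      have "\<Gamma> n = Some T"
        using Par.prems(5)[of n T] n m \<Delta>(1,4) agree_add_left by auto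
      then show "(\<Gamma> |` (- (inputs \<Gamma> - S))) n = Some T"
        using n m by (auto simp: S_def restrict_map_def inputs_def)
    qed
    show "\<Gamma> |` (- (inputs \<Gamma> \<inter> S)) \<turnstile> Q"
    proof (rule Par.IH(2)[OF \<Delta>(3) P'(2) tenv_restrict[OF Par.prems(3)] Par.prems(4)])
      fix n T assume n: "n \<in> fn Q" "val_typed \<Delta>\<^sub>2 (\<sigma> n) T"
      obtain m where m: "\<sigma> n = Nm m" using Par.prems(4)[of n] by (cases "\<sigma> n") auto
      have "\<Gamma> n = Some T"
        using Par.prems(5)[of n T] n m \<Delta>(1) by auto
      \<comment> \<open>If \<open>n\<close> were an input lying in \<open>S\<close>, its image would
        be an input of both \<open>\<Delta>\<^sub>1\<close> and
        \<open>\<Delta>\<^sub>2\<close>.\<close>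
      moreover have "\<not> (n \<in> inputs \<Gamma> \<and> n \<in> S)"
        using \<open>\<Gamma> n = Some T\<close> n m \<Delta>(5) by (auto simp: S_def inputs_def)
      ultimately show "(\<Gamma> |` (- (inputs \<Gamma> \<inter> S))) n = Some T"
        by (auto simp: restrict_map_def)
    qed
  qed
next
  case (In a x P)
  let ?x = "fresh_name x (image_names \<sigma> (fn P - {x}))"
  have fin: "finite (image_names \<sigma> (fn P - {x}))"
    by (simp add: finite_fn finite_image_names)
  from In.prems(2) obtain a' Q where Q: "subst_isubj \<sigma> a = Some a'"
    "subst (\<sigma>(x := Nm ?x)) P = Some Q" "P' = In a' ?x Q"
    by (auto simp: bind_eq_Some_conv Let_def)
  from In.prems(1) obtain T where T: "\<Delta> (I_name a') = Some (IT T)" "\<Delta>(?x \<mapsto> T) \<turnstile> Q"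
    by (auto simp: Q(3) elim: typed_InE)
  have "\<Gamma>(x \<mapsto> T) \<turnstile> P"
  proof (rule In.IH[OF T(2) Q(2)])
    show "tenv (\<Gamma>(x \<mapsto> T))"
      using tenv_upd_same_sort typed_tenv[OF T(2)] In.prems(3) fresh_name(1)[OF fin] by blast
    show "(\<sigma>(x := Nm ?x)) n \<noteq> Star" for n
      using In.prems(4) by simp
    fix n U assume n: "n \<in> fn P" "val_typed (\<Delta>(?x \<mapsto> T)) ((\<sigma>(x := Nm ?x)) n) U"
    show "(\<Gamma>(x \<mapsto> T)) n = Some U"
    proof (cases "n = x")
      case False
      then obtain m where m: "\<sigma> n = Nm m" "m \<noteq> ?x"
        using In.prems(4)[of n] n image_namesI[of n "fn P - {x}" \<sigma>] fresh_name(2)[OF fin]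
        by (cases "\<sigma> n") auto
      then show ?thesis using n False In.prems(5)[of n U] by simp
    qed (use n in simp)
  qed
  moreover have "\<Gamma> (I_name a) = Some (IT T)"
    using In.prems(5)[of "I_name a"] T(1) subst_isubj_SomeD[OF Q(1)] by simp
  ultimately show ?case
    using In.prems(3) by (auto intro: T_In)
next
  case (Out b v)
  from Out.prems(2) obtain b' where b': "subst_osubj \<sigma> b = Some b'" "P' = Out b' (subst_val \<sigma> v)"
    by auto
  from Out.prems(1) obtain T where T: "\<Delta> (O_name b') = Some (OT T)" "val_typed \<Delta> (subst_val \<sigma> v) T"
    by (auto simp: b'(2) elim: typed_OutE)
  have "\<Gamma> (O_name b) = Some (OT T)"
    using Out.prems(5)[of "O_name b"] T(1) subst_osubj_SomeD[OF b'(1)] by simp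
  moreover have "val_typed \<Gamma> v T"
    using Out.prems(5) T(2) by (cases v) auto
  ultimately show ?case
    using Out.prems(3) by (auto intro: T_Out)
next
  case (Res a b T P)
  define A where "A = image_names \<sigma> (fn P - {I_name a, P_name b})"
  define a' where "a' = fresh_iname a A"
  define b' where "b' = fresh_oname b A"
  let ?\<sigma> = "\<sigma>(I_name a := Nm (I_name a'), P_name b := Nm (P_name b'))"
  have fin: "finite A" by (simp add: A_def finite_fn finite_image_names)
  from Res.prems(2) obtain Q where Q: "subst ?\<sigma> P = Some Q" "P' = Res a' b' T Q"
    by (auto simp: Let_def A_def a'_def b'_def)
  from Res.prems(1) have vt: "\<Delta>(I_name a' \<mapsto> IT T, P_name b' \<mapsto> OT T) \<turnstile> Q"
    by (auto simp: Q(2) elim: typed_ResE)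
  have "\<Gamma>(I_name a \<mapsto> IT T, P_name b \<mapsto> OT T) \<turnstile> P"
  proof (rule Res.IH[OF vt Q(1) tenv_upd_Res[OF Res.prems(3)]])
    show "?\<sigma> n \<noteq> Star" for n
      using Res.prems(4) by simp
    fix n U
    assume n: "n \<in> fn P" "val_typed (\<Delta>(I_name a' \<mapsto> IT T, P_name b' \<mapsto> OT T)) (?\<sigma> n) U"
    show "(\<Gamma>(I_name a \<mapsto> IT T, P_name b \<mapsto> OT T)) n = Some U"
    proof (cases "n = I_name a \<or> n = P_name b")
      case False
      then obtain m where m: "\<sigma> n = Nm m" "m \<in> A"
        using Res.prems(4)[of n] n image_namesI[of n "fn P - {I_name a, P_name b}" \<sigma>]
        by (cases "\<sigma> n") (auto simp: A_def)
      then have "m \<noteq> I_name a'" "m \<noteq> P_name b'"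
        using fresh_iname[OF fin] fresh_oname[OF fin] by (auto simp: a'_def b'_def)
      then show ?thesis using n m False Res.prems(5)[of n U] by simp
    qed (use n in auto)
  qed
  then show ?case
    using Res.prems(3) by (auto intro: T_Res)
next
  case (Rep a x P)
  let ?x = "fresh_name x (image_names \<sigma> (fn P - {x}))"
  have fin: "finite (image_names \<sigma> (fn P - {x}))"
    by (simp add: finite_fn finite_image_names)
  from Rep.prems(2) obtain a' Q where Q: "subst_isubj \<sigma> a = Some a'"
    "subst (\<sigma>(x := Nm ?x)) P = Some Q" "P' = Rep a' ?x Q"
    by (auto simp: bind_eq_Some_conv Let_def)
  from Rep.prems(1) obtain T \<Delta>\<^sub>o where T: "\<Delta> (I_name a') = Some (IT T)" "\<Delta>\<^sub>o(?x \<mapsto> T) \<turnstile> Q"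
    "\<Delta>\<^sub>o \<subseteq>\<^sub>m \<Delta>" "only_outputs \<Delta>\<^sub>o"
    by (auto simp: Q(3) elim: typed_RepE)
  have "(outputs_part \<Gamma>)(x \<mapsto> T) \<turnstile> P"
  proof (rule Rep.IH[OF T(2) Q(2)])
    show "tenv ((outputs_part \<Gamma>)(x \<mapsto> T))"
      using tenv_upd_same_sort typed_tenv[OF T(2)] tenv_restrict[OF Rep.prems(3)]
        fresh_name(1)[OF fin] by blast
    show "(\<sigma>(x := Nm ?x)) n \<noteq> Star" for n
      using Rep.prems(4) by simp
    fix n U assume n: "n \<in> fn P" "val_typed (\<Delta>\<^sub>o(?x \<mapsto> T)) ((\<sigma>(x := Nm ?x)) n) U"
    show "((outputs_part \<Gamma>)(x \<mapsto> T)) n = Some U"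
    proof (cases "n = x")
      case False
      then obtain m where m: "\<sigma> n = Nm m" "m \<noteq> ?x"
        using Rep.prems(4)[of n] n image_namesI[of n "fn P - {x}" \<sigma>] fresh_name(2)[OF fin]
        by (cases "\<sigma> n") auto
      then have "\<Delta>\<^sub>o m = Some U" using n False by simp
      \<comment> \<open>The assumption linking the environments speaks of types in
        \<open>\<Delta>\<close>, so the type is lifted from \<open>\<Delta>\<^sub>o\<close>; being
        an output type, it is kept by \<open>outputs_part \<Gamma>\<close>.\<close>
      then obtain V where "\<Delta> m = Some U" "U = OT V"
        using T(3,4) by (meson map_leD only_outputsD)
      then show ?thesis using n m False Rep.prems(5)[of n U] by simp
    qed (use n in simp)
  qed
  moreover have "\<Gamma> (I_name a) = Some (IT T)"
    using Rep.prems(5)[of "I_name a"] T(1) subst_isubj_SomeD[OF Q(1)] by simp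
  ultimately show ?case
    using T_Rep[OF Rep.prems(3)] map_le_restrict only_outputs_outputs_part by blast
qed


section \<open>Structural congruence and typing\<close>

text \<open>From left to right, \<open>y\<close> is not the image of a free name other than
  \<open>x\<close>, so the renaming is injective where it matters; from right to left, typing is
  reflected.\<close>

lemma typed_alpha:
  assumes "same_sort x y" "y \<notin> fn P - {x}" "subst1 P (Nm y) x = Some P'" "tenv \<Gamma>"
  shows "\<Gamma>(x \<mapsto> T) \<turnstile> P \<longleftrightarrow> \<Gamma>(y \<mapsto> T) \<turnstile> P'"
proof
  assume P: "\<Gamma>(x \<mapsto> T) \<turnstile> P"
  have "subst_typed (\<Gamma>(x \<mapsto> T)) (fn P) (Nm(x := Nm y)) (\<Gamma>(y \<mapsto> T))"
    by (rule subst_typed_upd) (use assms(2) in \<open>auto simp: subst_typed_def image_names_def inj_on_def\<close>)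
  then show "\<Gamma>(y \<mapsto> T) \<turnstile> P'"
    using typed_subst[OF P] assms tenv_upd_same_sort[OF typed_tenv[OF P]] by (simp add: subst1_def)
next
  assume P': "\<Gamma>(y \<mapsto> T) \<turnstile> P'"
  show "\<Gamma>(x \<mapsto> T) \<turnstile> P"
    using assms tenv_upd_same_sort[OF typed_tenv[OF P']]
    by (intro typed_subst_reflect[OF P', of "Nm(x := Nm y)"]) (auto simp: subst1_def split: if_splits)
qed

lemma typed_alpha_Res:
  assumes "{I_name a', P_name b'} \<inter> fn (Res a b T P) = {}"
    "subst (Nm(I_name a := Nm (I_name a'), P_name b := Nm (P_name b'))) P = Some P'" "tenv \<Gamma>"
  shows "\<Gamma>(I_name a \<mapsto> IT T, P_name b \<mapsto> OT T) \<turnstile> P \<longleftrightarrow>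
    \<Gamma>(I_name a' \<mapsto> IT T, P_name b' \<mapsto> OT T) \<turnstile> P'"
proof
  assume P: "\<Gamma>(I_name a \<mapsto> IT T, P_name b \<mapsto> OT T) \<turnstile> P"
  have "subst_typed (\<Gamma>(I_name a \<mapsto> IT T)) (fn P - {P_name b})
      (Nm(I_name a := Nm (I_name a'))) (\<Gamma>(I_name a' \<mapsto> IT T))"
    by (rule subst_typed_upd) (use assms(1) in \<open>auto simp: subst_typed_def image_names_def inj_on_def\<close>)
  then have "subst_typed (\<Gamma>(I_name a \<mapsto> IT T, P_name b \<mapsto> OT T)) (fn P)
      (Nm(I_name a := Nm (I_name a'), P_name b := Nm (P_name b')))
      (\<Gamma>(I_name a' \<mapsto> IT T, P_name b' \<mapsto> OT T))"
    by (rule subst_typed_upd) (use assms(1) in \<open>auto simp: image_names_def split: if_splits\<close>)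
  then show "\<Gamma>(I_name a' \<mapsto> IT T, P_name b' \<mapsto> OT T) \<turnstile> P'"
    using typed_subst[OF P assms(2)] tenv_upd_Res[OF assms(3)] by simp
next
  assume P': "\<Gamma>(I_name a' \<mapsto> IT T, P_name b' \<mapsto> OT T) \<turnstile> P'"
  show "\<Gamma>(I_name a \<mapsto> IT T, P_name b \<mapsto> OT T) \<turnstile> P"
    using assms(1) tenv_upd_Res[OF assms(3)]
    by (intro typed_subst_reflect[OF P' assms(2)]) (auto split: if_splits)
qed

text \<open>The restricted names are absent from \<open>P\<close>, but on raw terms they may still
  occur in its environment, so they are removed there by \<open>typed_cong\<close>.\<close>

lemma typed_scope:
  assumes "{I_name a, P_name b} \<inter> fn P = {}"
  shows "\<Gamma> \<turnstile> Par P (Res a b T Q) \<longleftrightarrow> \<Gamma> \<turnstile> Res a b T (Par P Q)"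
proof
  assume "\<Gamma> \<turnstile> Par P (Res a b T Q)"
  then obtain \<Gamma>\<^sub>1 \<Gamma>\<^sub>2 where \<Gamma>: "\<Gamma> = \<Gamma>\<^sub>1 ++ \<Gamma>\<^sub>2" "\<Gamma>\<^sub>1 \<turnstile> P" "tenv \<Gamma>\<^sub>2"
    "\<Gamma>\<^sub>2(I_name a \<mapsto> IT T, P_name b \<mapsto> OT T) \<turnstile> Q" "agree \<Gamma>\<^sub>1 \<Gamma>\<^sub>2" "inputs \<Gamma>\<^sub>1 \<inter> inputs \<Gamma>\<^sub>2 = {}"
    by (auto elim!: typed_ParE typed_ResE)
  have ten: "tenv \<Gamma>" using \<Gamma> typed_tenv tenv_add by blast
  \<comment> \<open>Without this restriction, shadowed entries for \<open>a\<close> and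
    \<open>b\<close> could disagree with the types given by the binder, or \<open>a\<close> could be
    an input on both sides.\<close>
  let ?\<Gamma>\<^sub>1 = "\<Gamma>\<^sub>1 |` (- {I_name a, P_name b})"
  have "?\<Gamma>\<^sub>1 \<turnstile> P"
    using \<Gamma>(2) tenv_restrict[OF typed_tenv[OF \<Gamma>(2)]] by (rule typed_cong) (use assms in \<open>auto simp: restrict_map_def\<close>)
  moreover have "agree ?\<Gamma>\<^sub>1 (\<Gamma>\<^sub>2(I_name a \<mapsto> IT T, P_name b \<mapsto> OT T))"
    using \<Gamma>(5) by (intro agreeI) (auto simp: restrict_map_def dest: agreeD split: if_splits)
  moreover have "inputs ?\<Gamma>\<^sub>1 \<inter> inputs (\<Gamma>\<^sub>2(I_name a \<mapsto> IT T, P_name b \<mapsto> OT T)) = {}"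
    using \<Gamma>(6) by (auto simp: inputs_def restrict_map_def split: if_splits)
  moreover have "?\<Gamma>\<^sub>1 ++ \<Gamma>\<^sub>2(I_name a \<mapsto> IT T, P_name b \<mapsto> OT T) =
      \<Gamma>(I_name a \<mapsto> IT T, P_name b \<mapsto> OT T)"
    by (rule ext) (auto simp: \<Gamma>(1) map_add_def restrict_map_def)
  ultimately have "\<Gamma>(I_name a \<mapsto> IT T, P_name b \<mapsto> OT T) \<turnstile> Par P Q"
    using T_Par \<Gamma>(4) by metis
  then show "\<Gamma> \<turnstile> Res a b T (Par P Q)"
    using ten by (rule T_Res[rotated])
next
  assume "\<Gamma> \<turnstile> Res a b T (Par P Q)"
  then obtain \<Gamma>\<^sub>1 \<Gamma>\<^sub>2 where \<Gamma>: "tenv \<Gamma>" "\<Gamma>(I_name a \<mapsto> IT T, P_name b \<mapsto> OT T) = \<Gamma>\<^sub>1 ++ \<Gamma>\<^sub>2"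
    "\<Gamma>\<^sub>1 \<turnstile> P" "\<Gamma>\<^sub>2 \<turnstile> Q" "agree \<Gamma>\<^sub>1 \<Gamma>\<^sub>2" "inputs \<Gamma>\<^sub>1 \<inter> inputs \<Gamma>\<^sub>2 = {}"
    by (auto elim!: typed_ParE typed_ResE)
  let ?\<Gamma>\<^sub>1 = "\<Gamma>\<^sub>1 |` (- {I_name a, P_name b})" and ?\<Gamma>\<^sub>2 = "\<Gamma>\<^sub>2 |` (- {I_name a, P_name b})"
  have ten: "tenv ?\<Gamma>\<^sub>1" "tenv ?\<Gamma>\<^sub>2" using \<Gamma> typed_tenv tenv_restrict by blast+
  have "?\<Gamma>\<^sub>1 \<turnstile> P"
    using \<Gamma>(3) ten(1) by (rule typed_cong) (use assms in \<open>auto simp: restrict_map_def\<close>)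
  moreover have "?\<Gamma>\<^sub>2 \<turnstile> Res a b T Q"
  \<comment> \<open>The split may have given the input \<open>a\<close> to \<open>P\<close>, which
    does not use it; here it is handed over to \<open>Q\<close>.\<close>
  proof (rule T_Res[OF ten(2) typed_cong[OF \<Gamma>(4) tenv_upd_Res[OF ten(2)]]])
    fix n U assume "\<Gamma>\<^sub>2 n = Some U"
    then have "(\<Gamma>(I_name a \<mapsto> IT T, P_name b \<mapsto> OT T)) n = Some U"
      using \<Gamma>(2) by simp
    then show "(?\<Gamma>\<^sub>2(I_name a \<mapsto> IT T, P_name b \<mapsto> OT T)) n = Some U"
      using \<open>\<Gamma>\<^sub>2 n = Some U\<close> by (auto split: if_splits)
  qed
  moreover have "agree ?\<Gamma>\<^sub>1 ?\<Gamma>\<^sub>2"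
    using \<Gamma>(5) by (intro agreeI) (auto simp: restrict_map_def dest: agreeD split: if_splits)
  moreover have "inputs ?\<Gamma>\<^sub>1 \<inter> inputs ?\<Gamma>\<^sub>2 = {}"
    using \<Gamma>(6) by (auto simp: inputs_def restrict_map_def split: if_splits)
  ultimately have "?\<Gamma>\<^sub>1 ++ ?\<Gamma>\<^sub>2 \<turnstile> Par P (Res a b T Q)"
    by (rule T_Par)
  \<comment> \<open>Only an inclusion: entries of \<open>\<Gamma>\<close> for \<open>a\<close> and
    \<open>b\<close>, shadowed by the restriction, are lost and then restored by weakening.\<close>
  moreover have "?\<Gamma>\<^sub>1 ++ ?\<Gamma>\<^sub>2 \<subseteq>\<^sub>m \<Gamma>"
  proof (unfold map_le_def, rule ballI)
    fix n assume n: "n \<in> dom (?\<Gamma>\<^sub>1 ++ ?\<Gamma>\<^sub>2)"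
    then have "n \<noteq> I_name a" "n \<noteq> P_name b" by (auto simp: restrict_map_def split: if_splits)
    then show "(?\<Gamma>\<^sub>1 ++ ?\<Gamma>\<^sub>2) n = \<Gamma> n"
      using fun_cong[OF \<Gamma>(2), of n] by (simp add: map_add_def restrict_map_def)
  qed
  ultimately show "\<Gamma> \<turnstile> Par P (Res a b T Q)"
    using \<Gamma>(1) by (rule typed_weaken)
qed

lemma typed_Par_comm: "\<Gamma> \<turnstile> Par P Q \<Longrightarrow> \<Gamma> \<turnstile> Par Q P"
  by (erule typed_ParE) (metis T_Par agree_add_comm agree_sym Int_commute)

lemma typed_Par_assoc: "\<Gamma> \<turnstile> Par P (Par Q R) \<longleftrightarrow> \<Gamma> \<turnstile> Par (Par P Q) R"
proof
  assume "\<Gamma> \<turnstile> Par P (Par Q R)"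
  then obtain \<Gamma>\<^sub>1 \<Gamma>\<^sub>2 \<Gamma>\<^sub>3 where \<Gamma>: "\<Gamma> = \<Gamma>\<^sub>1 ++ (\<Gamma>\<^sub>2 ++ \<Gamma>\<^sub>3)" "\<Gamma>\<^sub>1 \<turnstile> P" "\<Gamma>\<^sub>2 \<turnstile> Q" "\<Gamma>\<^sub>3 \<turnstile> R"
    and ag: "agree \<Gamma>\<^sub>1 (\<Gamma>\<^sub>2 ++ \<Gamma>\<^sub>3)" "agree \<Gamma>\<^sub>2 \<Gamma>\<^sub>3"
    and dj: "inputs \<Gamma>\<^sub>1 \<inter> inputs (\<Gamma>\<^sub>2 ++ \<Gamma>\<^sub>3) = {}" "inputs \<Gamma>\<^sub>2 \<inter> inputs \<Gamma>\<^sub>3 = {}"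
    by (auto elim!: typed_ParE)
  have ag': "agree \<Gamma>\<^sub>1 \<Gamma>\<^sub>2" "agree \<Gamma>\<^sub>1 \<Gamma>\<^sub>3"
    using ag agree_add_iff agree_sym by blast+
  have "(\<Gamma>\<^sub>1 ++ \<Gamma>\<^sub>2) ++ \<Gamma>\<^sub>3 \<turnstile> Par (Par P Q) R"
    using \<Gamma> ag ag' dj by (intro T_Par) (auto simp: inputs_add agree_add_iff)
  then show "\<Gamma> \<turnstile> Par (Par P Q) R"
    by (simp add: \<Gamma>(1))
next
  assume "\<Gamma> \<turnstile> Par (Par P Q) R"
  then obtain \<Gamma>\<^sub>1 \<Gamma>\<^sub>2 \<Gamma>\<^sub>3 where \<Gamma>: "\<Gamma> = (\<Gamma>\<^sub>1 ++ \<Gamma>\<^sub>2) ++ \<Gamma>\<^sub>3" "\<Gamma>\<^sub>1 \<turnstile> P" "\<Gamma>\<^sub>2 \<turnstile> Q" "\<Gamma>\<^sub>3 \<turnstile> R"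
    and ag: "agree (\<Gamma>\<^sub>1 ++ \<Gamma>\<^sub>2) \<Gamma>\<^sub>3" "agree \<Gamma>\<^sub>1 \<Gamma>\<^sub>2"
    and dj: "inputs (\<Gamma>\<^sub>1 ++ \<Gamma>\<^sub>2) \<inter> inputs \<Gamma>\<^sub>3 = {}" "inputs \<Gamma>\<^sub>1 \<inter> inputs \<Gamma>\<^sub>2 = {}"
    by (auto elim!: typed_ParE)
  have ag': "agree \<Gamma>\<^sub>1 \<Gamma>\<^sub>3" "agree \<Gamma>\<^sub>2 \<Gamma>\<^sub>3"
    using ag agree_add_iff by blast+
  then have "agree \<Gamma>\<^sub>1 (\<Gamma>\<^sub>2 ++ \<Gamma>\<^sub>3)"
    using ag(2) agree_add_iff agree_sym by blast
  then have "\<Gamma>\<^sub>1 ++ (\<Gamma>\<^sub>2 ++ \<Gamma>\<^sub>3) \<turnstile> Par P (Par Q R)"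
    using \<Gamma> ag ag' dj by (intro T_Par) (auto simp: inputs_add)
  then show "\<Gamma> \<turnstile> Par P (Par Q R)"
    by (simp add: \<Gamma>(1))
qed

lemma typed_Par_Nil: "\<Gamma> \<turnstile> Par P PNil \<longleftrightarrow> \<Gamma> \<turnstile> P"
proof
  assume "\<Gamma> \<turnstile> Par P PNil"
  then obtain \<Gamma>\<^sub>1 \<Gamma>\<^sub>2 where "\<Gamma> = \<Gamma>\<^sub>1 ++ \<Gamma>\<^sub>2" "\<Gamma>\<^sub>1 \<turnstile> P" "agree \<Gamma>\<^sub>1 \<Gamma>\<^sub>2"
    by (auto elim!: typed_ParE)
  moreover have "tenv \<Gamma>" using \<open>\<Gamma> \<turnstile> Par P PNil\<close> by (rule typed_tenv)
  ultimately show "\<Gamma> \<turnstile> P"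
    by (auto intro: typed_cong dest: agree_add_left)
next
  assume "\<Gamma> \<turnstile> P"
  from T_Par[OF this T_Nil[OF tenv_empty]] show "\<Gamma> \<turnstile> Par P PNil"
    by (auto simp: inputs_def intro: agreeI)
qed

text \<open>Inversion and introduction as one equivalence, so that the congruence cases below are
  rewriting with the induction hypotheses.\<close>

lemma typed_Par_iff:
  "\<Gamma> \<turnstile> Par P Q \<longleftrightarrow> (\<exists>\<Gamma>\<^sub>1 \<Gamma>\<^sub>2. \<Gamma> = \<Gamma>\<^sub>1 ++ \<Gamma>\<^sub>2 \<and> \<Gamma>\<^sub>1 \<turnstile> P \<and> \<Gamma>\<^sub>2 \<turnstile> Q \<and> agree \<Gamma>\<^sub>1 \<Gamma>\<^sub>2 \<and>
    inputs \<Gamma>\<^sub>1 \<inter> inputs \<Gamma>\<^sub>2 = {})"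
  by (auto intro: T_Par elim!: typed_ParE)

lemma typed_Res_iff:
  "\<Gamma> \<turnstile> Res a b T P \<longleftrightarrow> tenv \<Gamma> \<and> \<Gamma>(I_name a \<mapsto> IT T, P_name b \<mapsto> OT T) \<turnstile> P"
  by (auto intro: T_Res elim!: typed_ResE)

lemma typed_In_iff:
  "\<Gamma> \<turnstile> In a x P \<longleftrightarrow> tenv \<Gamma> \<and> (\<exists>T. \<Gamma> (I_name a) = Some (IT T) \<and> \<Gamma>(x \<mapsto> T) \<turnstile> P)"
  by (auto intro: T_In elim!: typed_InE)

lemma typed_Rep_iff:
  "\<Gamma> \<turnstile> Rep a x P \<longleftrightarrow> tenv \<Gamma> \<and> (\<exists>T \<Gamma>\<^sub>o. \<Gamma> (I_name a) = Some (IT T) \<and> \<Gamma>\<^sub>o \<subseteq>\<^sub>m \<Gamma> \<and>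
    only_outputs \<Gamma>\<^sub>o \<and> \<Gamma>\<^sub>o(x \<mapsto> T) \<turnstile> P)"
  by (auto intro: T_Rep elim!: typed_RepE)

lemma typed_scong: "P \<cong> Q \<Longrightarrow> \<Gamma> \<turnstile> P \<longleftrightarrow> \<Gamma> \<turnstile> Q"
proof (induction arbitrary: \<Gamma> rule: scong.induct)
  case (alpha_In x y P P' a)
  from typed_alpha[OF this] show ?case by (auto simp: typed_In_iff)
next
  case (alpha_Rep x y P P' a)
  \<comment> \<open>A replicated body is typed in some \<open>\<Gamma>\<^sub>o\<close> below
    \<open>\<Gamma>\<close>, which inherits well-sortedness.\<close>
  have "\<Gamma>\<^sub>o(x \<mapsto> T) \<turnstile> P \<longleftrightarrow> \<Gamma>\<^sub>o(y \<mapsto> T) \<turnstile> P'" if "tenv \<Gamma>" "\<Gamma>\<^sub>o \<subseteq>\<^sub>m \<Gamma>" for T \<Gamma>\<^sub>o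
    using typed_alpha[OF alpha_Rep] tenv_mono that by blast
  then show ?case by (auto simp: typed_Rep_iff)
next
  case (alpha_Res a' b' a b T P P')
  from typed_alpha_Res[OF this] show ?case by (auto simp: typed_Res_iff)
next
  case (Par_comm P Q)
  then show ?case using typed_Par_comm by blast
next
  case (Res_swap a c b d T U P)
  \<comment> \<open>The side conditions and the difference in sort make all four names distinct, so
    the updates commute.\<close>
  then have "\<Gamma>(I_name a \<mapsto> IT T, P_name b \<mapsto> OT T, I_name c \<mapsto> IT U, P_name d \<mapsto> OT U) =
      \<Gamma>(I_name c \<mapsto> IT U, P_name d \<mapsto> OT U, I_name a \<mapsto> IT T, P_name b \<mapsto> OT T)"
    by auto
  then show ?case by (auto simp: typed_Res_iff tenv_upd_Res)
next
  case (Res_Nil a b T)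
  then show ?case by (auto simp: typed_Res_iff intro: T_Nil tenv_upd_Res elim: typed_NilE)
next
  case (scope a b P T Q)
  then show ?case by (rule typed_scope)
next
  case (cong_Par P P' Q Q')
  then show ?case by (simp add: typed_Par_iff)
qed (simp_all add: typed_Res_iff typed_In_iff typed_Rep_iff typed_Par_assoc typed_Par_Nil)


section \<open>Reduction\<close>

text \<open>Here \<open>\<Gamma>\<close> belongs to the receiver and \<open>\<Delta>\<close> to the
  sender. Disjointness of their inputs is the source of the injectivity required by
  \<open>typed_subst\<close>.\<close>

lemma typed_subst1:
  assumes "\<Gamma>(x \<mapsto> T) \<turnstile> P" "val_typed \<Delta> v T" "subst1 P v x = Some P'"
    "tenv \<Gamma>" "tenv \<Delta>" "agree \<Gamma> \<Delta>" "inputs \<Gamma> \<inter> inputs \<Delta> = {}"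
  shows "\<Gamma> ++ \<Delta> \<turnstile> P'"
proof (rule typed_subst[OF assms(1) assms(3)[unfolded subst1_def] tenv_add[OF assms(4,5)]])
  have "val_typed (\<Gamma> ++ \<Delta>) ((Nm(x := v)) n) U" if "(\<Gamma>(x \<mapsto> T)) n = Some U" for n U
    using that assms(2,6) by (auto simp: agree_add_left intro: val_typed_mono split: if_splits)
  \<comment> \<open>At an input type, \<open>v\<close> is an input of \<open>\<Delta>\<close> and
    hence none of \<open>\<Gamma>\<close>. At any other type, \<open>x\<close> is not an input and
    injectivity is that of the identity.\<close>
  moreover have "v \<noteq> Nm m" if "T = IT W" "m \<in> inputs \<Gamma>" for W m
    using that assms(2,7) by (auto simp: inputs_def)
  then have "inj_on (Nm(x := v)) (fn P \<inter> inputs (\<Gamma>(x \<mapsto> T)))"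
    by (fastforce simp: inj_on_def inputs_def split: if_splits)
  ultimately show "subst_typed (\<Gamma>(x \<mapsto> T)) (fn P) (Nm(x := v)) (\<Gamma> ++ \<Delta>)"
    by (auto simp: subst_typed_def)
qed

theorem theoremA3:
  fixes \<Gamma> :: env and P P' :: proc
  assumes "\<Gamma> \<turnstile> P" and "P \<longmapsto> P'"
  shows "\<Gamma> \<turnstile> P'"
  using assms(2,1)
proof (induction arbitrary: \<Gamma> rule: red.induct)
  case (com P v x P' a b T Q)
  let ?\<Gamma> = "\<Gamma>(I_name a \<mapsto> IT T, P_name b \<mapsto> OT T)"
  from com.prems have "?\<Gamma> \<turnstile> Par (Par (In a x P) (Out (Plain b) v)) Q"
    by (simp add: typed_Res_iff)
  then obtain \<Gamma>\<^sub>1 \<Gamma>\<^sub>2 \<Gamma>\<^sub>3 where \<Gamma>: "?\<Gamma> = (\<Gamma>\<^sub>1 ++ \<Gamma>\<^sub>2) ++ \<Gamma>\<^sub>3"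
    "\<Gamma>\<^sub>1 \<turnstile> In a x P" "\<Gamma>\<^sub>2 \<turnstile> Out (Plain b) v" "\<Gamma>\<^sub>3 \<turnstile> Q"
    and ag: "agree (\<Gamma>\<^sub>1 ++ \<Gamma>\<^sub>2) \<Gamma>\<^sub>3" "agree \<Gamma>\<^sub>1 \<Gamma>\<^sub>2"
    and dj: "inputs (\<Gamma>\<^sub>1 ++ \<Gamma>\<^sub>2) \<inter> inputs \<Gamma>\<^sub>3 = {}" "inputs \<Gamma>\<^sub>1 \<inter> inputs \<Gamma>\<^sub>2 = {}"
    unfolding typed_Par_iff by blast
  obtain U where U: "\<Gamma>\<^sub>1 (I_name a) = Some (IT U)" "\<Gamma>\<^sub>1(x \<mapsto> U) \<turnstile> P"
    using \<Gamma>(2) by (auto simp: typed_In_iff)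
  obtain V where V: "\<Gamma>\<^sub>2 (P_name b) = Some (OT V)" "val_typed \<Gamma>\<^sub>2 v V"
    using \<Gamma>(3) by (auto elim: typed_OutE)
  \<comment> \<open>The restriction gives both ends of the channel the same carried type
    \<open>T\<close>, which forces the types of parameter and value to coincide.\<close>
  have "?\<Gamma> (I_name a) = Some (IT U)" "?\<Gamma> (P_name b) = Some (OT V)"
    unfolding \<Gamma>(1) using U(1) V(1) ag by (auto intro: agree_add_left)
  then have "U = V" by simp
  then have "\<Gamma>\<^sub>1 ++ \<Gamma>\<^sub>2 \<turnstile> P'"
    using typed_subst1[OF U(2)] V(2) com.hyps \<Gamma>(2,3) typed_tenv ag(2) dj(2) by blast
  then have "?\<Gamma> \<turnstile> Par P' Q"
    using \<Gamma>(1,4) ag(1) dj(1) by (auto intro: T_Par)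
  then show ?case
    using com.prems by (simp add: typed_Res_iff)
next
  case (rep P v x P' a b T Q)
  let ?\<Gamma> = "\<Gamma>(I_name a \<mapsto> IT T, P_name b \<mapsto> OT T)"
  from rep.prems have "?\<Gamma> \<turnstile> Par (Par (Rep a x P) (Out (Plain b) v)) Q"
    by (simp add: typed_Res_iff)
  then obtain \<Gamma>\<^sub>1 \<Gamma>\<^sub>2 \<Gamma>\<^sub>3 where \<Gamma>: "?\<Gamma> = (\<Gamma>\<^sub>1 ++ \<Gamma>\<^sub>2) ++ \<Gamma>\<^sub>3"
    "\<Gamma>\<^sub>1 \<turnstile> Rep a x P" "\<Gamma>\<^sub>2 \<turnstile> Out (Plain b) v" "\<Gamma>\<^sub>3 \<turnstile> Q"
    and ag: "agree (\<Gamma>\<^sub>1 ++ \<Gamma>\<^sub>2) \<Gamma>\<^sub>3" "agree \<Gamma>\<^sub>1 \<Gamma>\<^sub>2"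
    and dj: "inputs (\<Gamma>\<^sub>1 ++ \<Gamma>\<^sub>2) \<inter> inputs \<Gamma>\<^sub>3 = {}" "inputs \<Gamma>\<^sub>1 \<inter> inputs \<Gamma>\<^sub>2 = {}"
    unfolding typed_Par_iff by blast
  obtain U \<Gamma>\<^sub>o where U: "\<Gamma>\<^sub>1 (I_name a) = Some (IT U)" "\<Gamma>\<^sub>o(x \<mapsto> U) \<turnstile> P"
    "\<Gamma>\<^sub>o \<subseteq>\<^sub>m \<Gamma>\<^sub>1" "only_outputs \<Gamma>\<^sub>o"
    using \<Gamma>(2) by (auto simp: typed_Rep_iff)
  obtain V where V: "\<Gamma>\<^sub>2 (P_name b) = Some (OT V)" "val_typed \<Gamma>\<^sub>2 v V"
    using \<Gamma>(3) by (auto elim: typed_OutE)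
  have "?\<Gamma> (I_name a) = Some (IT U)" "?\<Gamma> (P_name b) = Some (OT V)"
    unfolding \<Gamma>(1) using U(1) V(1) ag by (auto intro: agree_add_left)
  then have "U = V" by simp
  \<comment> \<open>The copy is typed in \<open>\<Gamma>\<^sub>o ++ \<Gamma>\<^sub>2\<close>. Since
    \<open>\<Gamma>\<^sub>o\<close> has no inputs, the inputs of this environment are those of
    \<open>\<Gamma>\<^sub>2\<close>, disjoint from \<open>\<Gamma>\<^sub>1\<close>, which the
    replicated process keeps whole.\<close>
  have ago: "agree \<Gamma>\<^sub>o \<Gamma>\<^sub>2" "agree \<Gamma>\<^sub>1 \<Gamma>\<^sub>o"
    using agree_mono[OF ag(2) U(3)] by (auto intro!: agreeI dest: map_leD[OF U(3)])
  have inpo: "inputs \<Gamma>\<^sub>o = {}"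
    using U(4) by (auto simp: inputs_def dest: only_outputsD)
  have "\<Gamma>\<^sub>o ++ \<Gamma>\<^sub>2 \<turnstile> P'"
    using typed_subst1[OF U(2), of \<Gamma>\<^sub>2 v P'] V(2) rep.hyps \<Gamma>(2,3) typed_tenv tenv_mono U(3)
      ago(1) inpo \<open>U = V\<close> by blast
  moreover have "agree \<Gamma>\<^sub>1 (\<Gamma>\<^sub>o ++ \<Gamma>\<^sub>2)"
    using ago ag(2) agree_add_iff agree_sym by blast
  \<comment> \<open>\<open>\<Gamma>\<^sub>o\<close> is already part of
    \<open>\<Gamma>\<^sub>1\<close>, so the copy does not enlarge the overall environment.\<close>
  moreover have "\<Gamma>\<^sub>1 ++ (\<Gamma>\<^sub>o ++ \<Gamma>\<^sub>2) = \<Gamma>\<^sub>1 ++ \<Gamma>\<^sub>2"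
  proof -
    have "\<Gamma>\<^sub>1 ++ \<Gamma>\<^sub>o = \<Gamma>\<^sub>1"
      by (rule ext) (auto simp: map_add_def dest: map_leD[OF U(3)] split: option.splits)
    then show ?thesis by simp
  qed
  ultimately have "\<Gamma>\<^sub>1 ++ \<Gamma>\<^sub>2 \<turnstile> Par (Rep a x P) P'"
    using T_Par[OF \<Gamma>(2)] dj(2) inpo ago(1) by (metis inputs_add sup_bot_left)
  then have "?\<Gamma> \<turnstile> Par (Par (Rep a x P) P') Q"
    using \<Gamma>(1,4) ag(1) dj(1) by (auto intro: T_Par)
  then show ?case
    using rep.prems by (simp add: typed_Res_iff)
next
  case (par P P' Q)
  then show ?case by (auto simp: typed_Par_iff)
next
  case (res P P' a b T)
  then show ?case by (auto simp: typed_Res_iff)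
next
  case (struct P P' P'' P''')
  then show ?case using typed_scong by blast
qed

end
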